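(* Let $g(z)=z+\sum_{n\ge 2}g_nz^n\in\mathbb{A}$, write $[n]_g=g_n$, and let $\phi(z)=1+B_1z+B_2z^2+\cdots$ be as in the context. If $f(z)=z+\sum_{n\ge2}a_nz^n\in\mathbb{A}$ belongs to $\mathcal{S}^{\ast}_g(\phi)$, then the symmetric Toeplitz determinant $$\mathcal{T}_3(1)=\begin{vmatrix} 1 & a_2 & a_3 \\ a_2 & 1 & a_2 \\ a_3 & a_2 & 1 \end{vmatrix}$$ satisfies $$|\mathcal{T}_3(1)|\le\left(1+\frac{B_1}{[3]_g-1}\max\left\{1,\left|\frac{B_2}{B_1}+\frac{B_1}{[2]_g-1}\left(1-2\frac{[3]_g-1}{[2]_g-1}\right)\right|\right\}\right)\left(1+\frac{B_1}{[3]_g-1}\max\left\{1,\left|\frac{B_2}{B_1}+\frac{B_1}{[2]_g-1}\right|\right\}\right).$$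
   Context: $\mathbb{U}=\{z\in\mathbb{C}:|z|<1\}$, and $\mathbb{A}$ is the set of analytic functions $f$ on $\mathbb{U}$ with $f(0)=0$, $f'(0)=1$, i.e. $f(z)=z+\sum_{n\ge2}a_nz^n$. For analytic $F,\phi$ on $\mathbb{U}$, $F\prec\phi$ (subordination) means there is an analytic $u$ on $\mathbb{U}$ with $u(0)=0$, $|u(z)|<1$ and $F(z)=\phi(u(z))$ for all $z\in\mathbb{U}$. For $g(z)=z+\sum_{n\ge2}g_nz^n\in\mathbb{A}$, the $g$-derivative of $f\in\mathbb{A}$ is $D_gf(z)=\frac1z\left(z+\sum_{n\ge2}[n]_ga_nz^n\right)$, where $[n]_g=g_n$ (so $zD_gf$ is the convolution, i.e. Hadamard product, of $f$ and $g$). The function $\phi$ is analytic on $\mathbb{U}$ with positive real part, $\phi(0)=1$, $\phi'(0)>0$, $\phi(\mathbb{U})$ symmetric with respect to the real axis, with expansion $\phi(z)=1+B_1z+B_2z^2+B_3z^3+\cdots$, $B_1>0$. The class $\mathcal{S}^{\ast}_g(\phi)$ consists of all $f\in\mathbb{A}$ such that $\frac{zD_gf(z)}{f(z)}\prec\phi(z)$.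
   Formalization: The formal theorem additionally assumes that [2]_g ≠ 1 and that [3]_g is real with [3]_g > 1; otherwise the bound is undefined or can fail (e.g. f(z)=z, g(z)=z−z²−z³, φ(z)=(1+z)/(1−z) gives 1 ≤ 0). *)

theory Defs
  imports "HOL-Complex_Analysis.Complex_Analysis"
begin

abbreviation unit_disc :: "complex set" ("\<U>")
  where "\<U> \<equiv> ball 0 1"

abbreviation taylor_coeff :: "(complex \<Rightarrow> complex) \<Rightarrow> nat \<Rightarrow> complex"
  where "taylor_coeff f n \<equiv> fps_nth (fps_expansion f 0) n"

definition normalized_analytic :: "(complex \<Rightarrow> complex) set" ("\<A>")
  where "\<A> = {f. f analytic_on \<U> \<and> f 0 = 0 \<and> deriv f 0 = 1}"

definition subordinate :: "(complex \<Rightarrow> complex) \<Rightarrow> (complex \<Rightarrow> complex) \<Rightarrow> bool" (infix "\<prec>\<^sub>U" 50)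
  where "F \<prec>\<^sub>U \<phi> \<longleftrightarrow> F analytic_on \<U> \<and> \<phi> analytic_on \<U> \<and>
    (\<exists>u. u analytic_on \<U> \<and> u 0 = 0 \<and> (\<forall>z\<in>\<U>. norm (u z) < 1 \<and> F z = \<phi> (u z)))"

text \<open>
  The value at \<open>0\<close> is the one that removes the singularity of the factor \<open>1 / z\<close>.
\<close>
definition g_deriv :: "(complex \<Rightarrow> complex) \<Rightarrow> (complex \<Rightarrow> complex) \<Rightarrow> complex \<Rightarrow> complex"
  where "g_deriv g f z =
    (if z = 0 then 1
     else (1 / z) * (z + (\<Sum>n. taylor_coeff g (n + 2) * taylor_coeff f (n + 2) * z ^ (n + 2))))"

definition admissible :: "(complex \<Rightarrow> complex) \<Rightarrow> bool"
  where "admissible \<phi> \<longleftrightarrow>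
    \<phi> analytic_on \<U> \<and> (\<forall>z\<in>\<U>. 0 < Re (\<phi> z)) \<and> \<phi> 0 = 1 \<and>
    deriv \<phi> 0 \<in> \<real> \<and> 0 < Re (deriv \<phi> 0) \<and> cnj ` (\<phi> ` \<U>) = \<phi> ` \<U>"

text \<open>
  The quotient \<open>z D\<^sub>g f(z) / f(z)\<close> is \<open>0 / 0\<close> at the origin; \<^const>\<open>remove_sings\<close> turns it into the
  analytic function meant by the notation.  It assigns \<open>0\<close> to a pole, and \<open>0\<close> is not a value
  of an admissible \<open>\<phi>\<close>, so a quotient with a pole in the disc is never subordinate to \<open>\<phi>\<close>.
\<close>
definition S_star :: "(complex \<Rightarrow> complex) \<Rightarrow> (complex \<Rightarrow> complex) \<Rightarrow> (complex \<Rightarrow> complex) set"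
  where "S_star g \<phi> = {f \<in> \<A>. remove_sings (\<lambda>z. z * g_deriv g f z / f z) \<prec>\<^sub>U \<phi>}"

end

theory Submission
  imports Defs
begin

text \<open>
  The determinant factors as \<open>(1 - a\<^sub>3) (1 + a\<^sub>3 - 2 a\<^sub>2\<^sup>2)\<close>, so it suffices to bound
  \<open>\<bar>a\<^sub>3\<bar>\<close> and \<open>\<bar>a\<^sub>3 - 2 a\<^sub>2\<^sup>2\<bar>\<close>, two functionals of the form \<open>\<bar>a\<^sub>3 - \<lambda> a\<^sub>2\<^sup>2\<bar>\<close>.

  Let \<open>u(z) = c z + d z\<^sup>2 + \<dots>\<close> be the Schwarz function of the subordination, so that
  \<open>z D\<^sub>g f = f \<cdot> (\<phi> \<circ> u)\<close>.  Comparing coefficients of \<open>z\<^sup>2\<close> and \<open>z\<^sup>3\<close>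
  (lemma \<open>S_star_coefficients\<close>) gives
  \<open>(g\<^sub>2 - 1) a\<^sub>2 = B\<^sub>1 c\<close> and \<open>(g\<^sub>3 - 1) a\<^sub>3 = B\<^sub>1 c a\<^sub>2 + B\<^sub>1 d + B\<^sub>2 c\<^sup>2\<close>.
  Eliminating \<open>a\<^sub>2\<close> turns both functionals into
  \<open>B\<^sub>1 / (g\<^sub>3 - 1) \<cdot> \<bar>d + \<kappa> c\<^sup>2\<bar>\<close>, where \<open>\<kappa>\<close> is the number inside the
  corresponding maximum of the claim.  Finally \<open>\<bar>d + \<kappa> c\<^sup>2\<bar> \<le> max {1, \<bar>\<kappa>\<bar>}\<close>
  (lemma \<open>schwarz_fekete_szego\<close>), because \<open>\<bar>d\<bar> \<le> 1 - \<bar>c\<bar>\<^sup>2\<close>, which is the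
  Schwarz-Pick inequality at the origin for \<open>u(z) / z\<close>.
\<close>

section \<open>Schwarz functions and their first two coefficients\<close>

text \<open>
  The Schwarz lemma bounds by \<open>1\<close> the derivative at \<open>0\<close> of \<open>v\<close> followed by the disc
  automorphism that sends \<open>v 0\<close> to \<open>0\<close>; that automorphism has derivative
  \<open>1 / (1 - \<bar>v 0\<bar>\<^sup>2)\<close> at \<open>v 0\<close>.  If \<open>v\<close> attains a value of modulus \<open>1\<close>,
  the maximum principle makes it constant.  This case must be allowed, since \<open>u(z) / z\<close> is a
  unimodular constant when \<open>u\<close> is a rotation.
\<close>
lemma schwarz_pick_at_0:
  assumes hol: "v holomorphic_on ball 0 1"
    and le1: "\<And>z. norm z < 1 \<Longrightarrow> norm (v z) \<le> 1"
  shows "norm (deriv v 0) \<le> 1 - (norm (v 0))\<^sup>2"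
proof (cases "\<exists>w. norm w < 1 \<and> norm (v w) = 1")
  case True
  then obtain w where w: "norm w < 1" "norm (v w) = 1"
    by blast
  have "v constant_on ball 0 1"
  proof (rule Schwarz2[OF hol, of "1 - norm w" w])
    show "ball w (1 - norm w) \<subseteq> ball 0 1"
    proof
      fix x assume "x \<in> ball w (1 - norm w)"
      then show "x \<in> ball 0 1"
        using norm_triangle_sub[of x w] by (simp add: dist_norm norm_minus_commute)
    qed
    then show "norm (v z) \<le> norm (v w)" if "norm (w - z) < 1 - norm w" for z
      using that w le1[of z] by (auto simp: dist_norm subset_iff)
  qed (use w in auto)
  then obtain c where c: "\<And>z. norm z < 1 \<Longrightarrow> v z = c"
    by (auto simp: constant_on_def)
  have "eventually (\<lambda>z. z \<in> ball 0 1) (nhds (0::complex))"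
    by (intro eventually_nhds_in_open) auto
  then have "eventually (\<lambda>z. v z = c) (nhds 0)"
    by eventually_elim (auto simp: c)
  then have "deriv v 0 = deriv (\<lambda>_. c) 0"
    by (rule deriv_cong_ev) simp
  then show ?thesis
    using le1[of 0] by (simp add: power_le_one)
next
  case False
  then have lt1: "norm (v z) < 1" if "norm z < 1" for z
    using le1[OF that] that by force
  define a where "a = v 0"
  define M where "M = Moebius_function 0 a"
  have a: "norm a < 1"
    using lt1[of 0] by (simp add: a_def)
  define k where "k = 1 - (norm a)\<^sup>2"
  have k: "k > 0"
    using a by (simp add: k_def power_less_one_iff)
  have ck: "1 - cnj a * a = complex_of_real k"
    by (simp add: k_def complex_norm_square[symmetric] mult.commute)
  have holM: "M holomorphic_on ball 0 1"
    unfolding M_def by (rule Moebius_function_holomorphic[OF a])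
  have dv: "(v has_field_derivative deriv v 0) (at 0)"
    by (rule holomorphic_derivI[OF hol]) auto
  have "((\<lambda>z. (z - a) / (1 - cnj a * z)) has_field_derivative
      (1 * (1 - cnj a * a) - (a - a) * (- cnj a)) / ((1 - cnj a * a) * (1 - cnj a * a))) (at a)"
    by (rule DERIV_divide) (use k ck in \<open>auto intro!: derivative_eq_intros\<close>)
  then have "((\<lambda>z. (z - a) / (1 - cnj a * z)) has_field_derivative 1 / k) (at (v 0))"
    using k unfolding ck by (simp add: a_def)
  then have dM: "(M has_field_derivative 1 / k) (at (v 0))"
    by (simp add: M_def Moebius_function_simple[abs_def])
  have "deriv (M \<circ> v) 0 = 1 / k * deriv v 0"
    by (rule DERIV_imp_deriv DERIV_chain dM dv)+
  moreover have "norm (deriv (M \<circ> v) 0) \<le> 1"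
  proof (rule Schwarz_Lemma(2)[where \<xi> = 0])
    show "(M \<circ> v) holomorphic_on ball 0 1"
      by (rule holomorphic_on_compose_gen[OF hol holM]) (auto simp: lt1)
    show "(M \<circ> v) 0 = 0"
      by (simp add: M_def a_def Moebius_function_eq_zero)
    show "norm ((M \<circ> v) z) < 1" if "norm z < 1" for z
      using that lt1 a by (simp add: M_def Moebius_function_norm_lt_1)
  qed simp
  ultimately have "norm (deriv v 0) / k \<le> 1"
    using k by (simp add: norm_mult norm_divide)
  then show ?thesis
    using k by (simp add: k_def a_def field_simps)
qed

text \<open>
  The first two coefficients of \<open>u\<close> are the value and the derivative at \<open>0\<close> of \<open>u(z) / z\<close>,
  which maps the disc into the closed disc by the Schwarz lemma.
\<close>
lemma schwarz_coeff_2_le: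
  assumes ana: "u analytic_on \<U>" and u0: "u 0 = 0"
    and lt1: "\<And>z. z \<in> \<U> \<Longrightarrow> norm (u z) < 1"
  shows "norm (taylor_coeff u 2) \<le> 1 - (norm (taylor_coeff u 1))\<^sup>2"
proof -
  have hol: "u holomorphic_on ball 0 1"
    using ana by (rule analytic_imp_holomorphic)
  obtain v where v: "v holomorphic_on ball 0 1" "\<And>z. norm z < 1 \<Longrightarrow> u z = z * v z"
      "deriv u 0 = v 0"
    using Schwarz3[OF hol u0] by blast
  have "norm (v z) \<le> 1" if z: "norm z < 1" for z
  proof (cases "z = 0")
    case True
    then show ?thesis
      using Schwarz_Lemma(2)[OF hol u0, of 0] lt1 v(3) by simp
  next
    case False
    then show ?thesis
      using Schwarz_Lemma(1)[OF hol u0, of z] lt1 z v(2)[OF z] by (simp add: norm_mult)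
  qed
  then have bound: "norm (deriv v 0) \<le> 1 - (norm (v 0))\<^sup>2"
    by (rule schwarz_pick_at_0[OF v(1)])
  have "v analytic_on {0}"
    using v(1) by (auto simp: analytic_at intro!: exI[of _ "ball 0 1"])
  then have "v has_fps_expansion fps_expansion v 0"
    by (rule analytic_at_imp_has_fps_expansion_0)
  then have zv: "(\<lambda>z. z * v z) has_fps_expansion fps_X * fps_expansion v 0"
    by (intro fps_expansion_intros)
  have "eventually (\<lambda>z. z \<in> ball 0 1) (nhds (0::complex))"
    by (intro eventually_nhds_in_open) auto
  then have "eventually (\<lambda>z. z * v z = u z) (nhds 0)"
    by eventually_elim (auto simp: v(2))
  from iffD1[OF has_fps_expansion_cong[OF this refl] zv]
  have "u has_fps_expansion fps_X * fps_expansion v 0" .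
  then have eq: "fps_expansion u 0 = fps_X * fps_expansion v 0"
    by (rule fps_expansion_eqI)
  have "taylor_coeff u 2 = deriv v 0" "taylor_coeff u 1 = v 0"
    unfolding eq by (simp_all add: fps_expansion_def)
  then show ?thesis
    using bound by simp
qed

text \<open>
  With \<open>t\<close> the squared modulus of the first coefficient, the triangle inequality leaves
  \<open>(1 - t) \<cdot> 1 + t \<cdot> \<bar>\<mu>\<bar>\<close>, a convex combination of \<open>1\<close> and \<open>\<bar>\<mu>\<bar>\<close>.
\<close>
lemma schwarz_fekete_szego:
  assumes "u analytic_on \<U>" "u 0 = 0" "\<And>z. z \<in> \<U> \<Longrightarrow> norm (u z) < 1"
  shows "norm (taylor_coeff u 2 + \<mu> * (taylor_coeff u 1)\<^sup>2) \<le> max 1 (norm \<mu>)"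
proof -
  define t where "t = (norm (taylor_coeff u 1))\<^sup>2"
  have c2: "norm (taylor_coeff u 2) \<le> 1 - t"
    unfolding t_def by (rule schwarz_coeff_2_le[OF assms])
  have t: "0 \<le> t" "t \<le> 1"
    using order_trans[OF norm_ge_zero c2] by (simp_all add: t_def)
  have "norm (taylor_coeff u 2 + \<mu> * (taylor_coeff u 1)\<^sup>2) \<le> (1 - t) + norm \<mu> * t"
    by (rule norm_triangle_le) (use c2 in \<open>simp add: t_def norm_mult norm_power\<close>)
  also have "\<dots> \<le> (1 - t) * max 1 (norm \<mu>) + max 1 (norm \<mu>) * t"
    using t mult_left_mono[of 1 "max 1 (norm \<mu>)" "1 - t"] by (intro add_mono mult_right_mono) auto
  also have "\<dots> = max 1 (norm \<mu>)"
    by (simp add: algebra_simps)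
  finally show ?thesis .
qed

section \<open>The power series of the convolution\<close>

text \<open>
  For \<open>r\<close> below both radii of convergence, the terms of one series at \<open>r\<close> are bounded and those of
  the other are absolutely summable, so the Hadamard product converges at radius \<open>r\<^sup>2\<close>.
\<close>
lemma fps_conv_radius_hadamard_pos:
  fixes F G :: "'a :: {banach, real_normed_field} fps"
  assumes F: "fps_conv_radius F > 0" and G: "fps_conv_radius G > 0"
  shows "fps_conv_radius (Abs_fps (\<lambda>n. fps_nth F n * fps_nth G n)) > 0"
proof -
  obtain r where r: "0 < ereal r" "ereal r < min (fps_conv_radius F) (fps_conv_radius G)"
    using F G ereal_dense2[of 0 "min (fps_conv_radius F) (fps_conv_radius G)"] by auto
  define x :: 'a where "x = of_real r"
  have x: "norm x < fps_conv_radius F" "norm x < fps_conv_radius G"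
    using r by (auto simp: x_def)
  have "Bseq (\<lambda>n. fps_nth F n * x ^ n)"
    by (intro convergent_imp_Bseq) (use summable_LIMSEQ_zero[OF summable_fps[OF x(1)]] in \<open>auto simp: convergent_def\<close>)
  then obtain K where K: "\<And>n. norm (fps_nth F n * x ^ n) \<le> K"
    by (auto simp: Bseq_def)
  have "summable (\<lambda>n. K * norm (fps_nth G n * x ^ n))"
    by (intro summable_mult norm_summable_fps x)
  then have "summable (\<lambda>n. (fps_nth F n * fps_nth G n) * (x\<^sup>2) ^ n)"
  proof (rule summable_comparison_test')
    show "norm ((fps_nth F n * fps_nth G n) * (x\<^sup>2) ^ n) \<le> K * norm (fps_nth G n * x ^ n)" for n
    proof -
      have "norm ((fps_nth F n * fps_nth G n) * (x\<^sup>2) ^ n) =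
          norm (fps_nth F n * x ^ n) * norm (fps_nth G n * x ^ n)"
        by (simp add: norm_mult[symmetric] power2_eq_square power_mult_distrib mult_ac)
      also have "\<dots> \<le> K * norm (fps_nth G n * x ^ n)"
        by (intro mult_right_mono K) auto
      finally show ?thesis .
    qed
  qed
  then have "conv_radius (\<lambda>n. fps_nth F n * fps_nth G n) \<ge> norm (x\<^sup>2)"
    by (rule conv_radius_geI)
  moreover have "ereal (norm (x\<^sup>2)) > 0"
    using r by (simp add: x_def)
  ultimately show ?thesis
    unfolding fps_conv_radius_def fps_nth_Abs_fps using less_le_trans by blast
qed

lemma normalized_analytic_expansion:
  assumes "f \<in> \<A>"
  shows "f has_fps_expansion fps_expansion f 0" "taylor_coeff f 0 = 0" "taylor_coeff f 1 = 1"
proof -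
  have "f analytic_on {0}"
    using assms by (auto simp: normalized_analytic_def intro: analytic_on_subset)
  then show "f has_fps_expansion fps_expansion f 0"
    by (rule analytic_at_imp_has_fps_expansion_0)
qed (use assms in \<open>auto simp: normalized_analytic_def fps_expansion_def\<close>)

lemma g_deriv_has_fps_expansion:
  assumes f: "f \<in> \<A>" and g: "g \<in> \<A>"
  shows "(\<lambda>z. z * g_deriv g f z) has_fps_expansion
    Abs_fps (\<lambda>n. taylor_coeff g n * taylor_coeff f n)"
    (is "_ has_fps_expansion ?H")
proof -
  note F = normalized_analytic_expansion[OF f] and G = normalized_analytic_expansion[OF g]
  have rad: "fps_conv_radius ?H > 0"
    using F(1) G(1) by (intro fps_conv_radius_hadamard_pos) (auto simp: has_fps_expansion_def)
  then have "eventually (\<lambda>z. z \<in> eball 0 (fps_conv_radius ?H)) (nhds 0)"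
    by (intro eventually_nhds_in_open) (auto simp: zero_ereal_def)
  then have "eventually (\<lambda>z. eval_fps ?H z = z * g_deriv g f z) (nhds 0)"
  proof eventually_elim
    case (elim z)
    then have "summable (\<lambda>n. fps_nth ?H n * z ^ n)"
      by (intro summable_fps) auto
    from suminf_split_initial_segment[OF this, of 2]
    have "eval_fps ?H z = z + (\<Sum>n. taylor_coeff g (n + 2) * taylor_coeff f (n + 2) * z ^ (n + 2))"
      using F(2,3) G(2,3) by (simp add: eval_fps_def numeral_2_eq_2)
    then show ?case
      by (auto simp: g_deriv_def)
  qed
  with rad show ?thesis
    by (simp add: has_fps_expansion_def)
qed

section \<open>Coefficient relations in the class\<close>

text \<open>
  Both \<open>z D\<^sub>g f\<close> and \<open>f\<close> vanish to first order at \<open>0\<close>, so their quotient has a removable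
  singularity there; multiplying the quotient back by \<open>f\<close> gives a relation between power series
  that determines its coefficients.
\<close>
lemma g_quotient_expansion:
  assumes f: "f \<in> \<A>" and g: "g \<in> \<A>"
  defines "P \<equiv> remove_sings (\<lambda>z. z * g_deriv g f z / f z)"
  shows "fps_expansion P 0 * fps_expansion f 0 =
    Abs_fps (\<lambda>n. taylor_coeff g n * taylor_coeff f n)" (is "_ * ?F = ?H")
proof -
  note F = normalized_analytic_expansion[OF f] and G = normalized_analytic_expansion[OF g]
  have sd: "subdegree ?F = 1"
    using F by (intro subdegreeI) auto
  have H: "fps_nth ?H 0 = 0" "fps_nth ?H 1 = 1" "fps_nth ?H (Suc 0) = 1"
    using F G by simp_all
  have sdH: "subdegree ?H = 1"
    using H by (intro subdegreeI) auto
  have nz: "?F \<noteq> 0"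
    using F(3) by auto
  \<comment> \<open>The value 1 at the origin is the ratio of the leading coefficients.\<close>
  define Q where "Q = (\<lambda>z. if z = 0 then 1 else z * g_deriv g f z / f z)"
  have Q: "Q has_fps_expansion ?H / ?F"
    unfolding Q_def
    by (intro has_fps_expansion_divide g_deriv_has_fps_expansion f g F(1) nz)
       (use sd sdH F G in auto)
  \<comment> \<open>\<^const>\<open>remove_sings\<close> depends only on punctured neighbourhoods, hence ignores the value at 0.\<close>
  have "P z = remove_sings Q z" for z
    unfolding P_def
  proof (rule remove_sings_cong)
    have "eventually (\<lambda>w. w \<noteq> 0) (at z)"
      by (rule eventually_neq_at_within)
    then show "eventually (\<lambda>w. w * g_deriv g f w / f w = Q w) (at z)"
      by eventually_elim (simp add: Q_def)
  qed simp
  then have "P = remove_sings Q"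
    by blast
  moreover have "eventually (\<lambda>w. remove_sings Q w = Q w) (nhds 0)"
    by (intro eventually_remove_sings_eq_nhds has_fps_expansion_imp_analytic_0[OF Q])
  ultimately have "P has_fps_expansion ?H / ?F"
    using Q has_fps_expansion_cong[of P Q] by simp
  then have "fps_expansion P 0 = ?H / ?F"
    by (rule fps_expansion_eqI)
  moreover have "?F dvd ?H"
    using nz sd sdH H by (subst fps_dvd_iff) auto
  ultimately show ?thesis
    by simp
qed

text \<open>
  These are the coefficients of \<open>z\<^sup>2\<close> and \<open>z\<^sup>3\<close> in \<open>z D\<^sub>g f = f \<cdot> (\<phi> \<circ> u)\<close>, with those of
  \<open>\<phi> \<circ> u\<close> expressed through \<open>\<phi>\<close> and the Schwarz function \<open>u\<close>.
\<close>
lemma S_star_coefficients: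
  assumes g: "g \<in> \<A>" and \<phi>: "\<phi> 0 = 1" and f: "f \<in> S_star g \<phi>"
  obtains u where
    "u analytic_on \<U>" "u 0 = 0" "\<And>z. z \<in> \<U> \<Longrightarrow> norm (u z) < 1"
    "(taylor_coeff g 2 - 1) * taylor_coeff f 2 = taylor_coeff \<phi> 1 * taylor_coeff u 1"
    "(taylor_coeff g 3 - 1) * taylor_coeff f 3 =
      taylor_coeff \<phi> 1 * taylor_coeff u 1 * taylor_coeff f 2 +
      taylor_coeff \<phi> 1 * taylor_coeff u 2 + taylor_coeff \<phi> 2 * (taylor_coeff u 1)\<^sup>2"
proof -
  define P where "P = remove_sings (\<lambda>z. z * g_deriv g f z / f z)"
  have fA: "f \<in> \<A>" and sub: "P \<prec>\<^sub>U \<phi>"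
    using f by (auto simp: S_star_def P_def)
  then obtain u where \<phi>_ana: "\<phi> analytic_on \<U>"
    and u: "u analytic_on \<U>" "u 0 = 0" "\<And>z. z \<in> \<U> \<Longrightarrow> norm (u z) < 1"
    and Pu: "\<And>z. z \<in> \<U> \<Longrightarrow> P z = \<phi> (u z)"
    by (auto simp: subordinate_def)
  have "\<phi> analytic_on {0}" "u analytic_on {0}"
    using \<phi>_ana u(1) by (auto intro: analytic_on_subset)
  then have "(\<phi> \<circ> u) has_fps_expansion fps_compose (fps_expansion \<phi> 0) (fps_expansion u 0)"
    using u(2)
    by (intro has_fps_expansion_compose analytic_at_imp_has_fps_expansion_0)
       (simp_all add: fps_expansion_def)
  also have "eventually (\<lambda>z. z \<in> \<U>) (nhds (0::complex))"
    by (intro eventually_nhds_in_open) auto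
  then have "eventually (\<lambda>z. (\<phi> \<circ> u) z = P z) (nhds 0)"
    by eventually_elim (simp add: Pu)
  then have "(\<phi> \<circ> u) has_fps_expansion fps_compose (fps_expansion \<phi> 0) (fps_expansion u 0) \<longleftrightarrow>
      P has_fps_expansion fps_compose (fps_expansion \<phi> 0) (fps_expansion u 0)"
    by (rule has_fps_expansion_cong) simp
  finally have P: "fps_expansion P 0 = fps_compose (fps_expansion \<phi> 0) (fps_expansion u 0)"
    by (rule fps_expansion_eqI)
  have zeros: "taylor_coeff u 0 = 0" "taylor_coeff \<phi> 0 = 1"
    using u(2) \<phi> by (simp_all add: fps_expansion_def)
  have P0: "taylor_coeff P 0 = 1"
    and P1: "taylor_coeff P 1 = taylor_coeff \<phi> 1 * taylor_coeff u 1"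
    and P2: "taylor_coeff P 2 =
      taylor_coeff \<phi> 1 * taylor_coeff u 2 + taylor_coeff \<phi> 2 * (taylor_coeff u 1)\<^sup>2"
    unfolding P
    by (simp_all add: fps_compose_nth fps_mult_nth zeros numeral_2_eq_2 power2_eq_square)
  note F = normalized_analytic_expansion(2,3)[OF fA]
  have eq: "fps_nth (fps_expansion P 0 * fps_expansion f 0) n =
      taylor_coeff g n * taylor_coeff f n" for n
    unfolding P_def g_quotient_expansion[OF fA g] by simp
  have "taylor_coeff f 2 + taylor_coeff P 1 = taylor_coeff g 2 * taylor_coeff f 2"
    using eq[of 2] F P0 by (simp add: fps_mult_nth numeral_2_eq_2)
  then have "(taylor_coeff g 2 - 1) * taylor_coeff f 2 = taylor_coeff \<phi> 1 * taylor_coeff u 1"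
    unfolding P1 by (simp add: algebra_simps)
  moreover have "taylor_coeff f 3 + taylor_coeff P 1 * taylor_coeff f 2 + taylor_coeff P 2 =
      taylor_coeff g 3 * taylor_coeff f 3"
    using eq[of 3] F P0 by (simp add: fps_mult_nth numeral_2_eq_2 numeral_3_eq_3)
  then have "(taylor_coeff g 3 - 1) * taylor_coeff f 3 =
      taylor_coeff \<phi> 1 * taylor_coeff u 1 * taylor_coeff f 2 +
      taylor_coeff \<phi> 1 * taylor_coeff u 2 + taylor_coeff \<phi> 2 * (taylor_coeff u 1)\<^sup>2"
    unfolding P1 P2 by (simp add: algebra_simps)
  ultimately show thesis
    using that u by blast
qed

section \<open>The Toeplitz determinant\<close>

text \<open>
  Subtracting the third row from the first leaves \<open>(1 - b) (1, 0, -1)\<close>, which splits off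
  the factor \<open>1 - b\<close>.
\<close>
lemma det_symmetric_toeplitz_3:
  "det (vector [vector [1, a, b], vector [a, 1, a], vector [b, a, 1]] :: 'a::comm_ring_1 ^ 3 ^ 3) =
    (1 - b) * (1 + (b - 2 * a\<^sup>2))"
  by (simp add: det_3 algebra_simps power2_eq_square)

theorem theorem2p19:
  fixes f g \<phi> :: "complex \<Rightarrow> complex"
    and a2 a3 g2 B2 :: complex
    and g3 B1 :: real
  assumes "g \<in> \<A>"
    and "admissible \<phi>"
    and "f \<in> S_star g \<phi>"
    and "a2 = taylor_coeff f 2" and "a3 = taylor_coeff f 3"
    and "g2 = taylor_coeff g 2" and "complex_of_real g3 = taylor_coeff g 3"
    and "complex_of_real B1 = taylor_coeff \<phi> 1" and "B2 = taylor_coeff \<phi> 2"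
    and "g2 \<noteq> 1" and "g3 > 1"
  shows "norm (det (vector [vector [1, a2, a3],
                            vector [a2, 1, a2],
                            vector [a3, a2, 1]] :: complex ^ 3 ^ 3))
    \<le> (1 + B1 / (g3 - 1) *
            max 1 (norm (B2 / B1 + B1 / (g2 - 1) * (1 - 2 * ((g3 - 1) / (g2 - 1))))))
      * (1 + B1 / (g3 - 1) * max 1 (norm (B2 / B1 + B1 / (g2 - 1))))"
proof -
  have "\<phi> 0 = 1" "Re (deriv \<phi> 0) > 0"
    using assms(2) by (auto simp: admissible_def)
  moreover have "deriv \<phi> 0 = complex_of_real B1"
    using assms(8) by (simp add: fps_expansion_def)
  ultimately have \<phi>0: "\<phi> 0 = 1" and B1: "B1 > 0"
    by simp_all
  obtain u where u: "u analytic_on \<U>" "u 0 = 0" "\<And>z. z \<in> \<U> \<Longrightarrow> norm (u z) < 1"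
    and coeff2: "(g2 - 1) * a2 = B1 * taylor_coeff u 1"
    and coeff3: "(complex_of_real g3 - 1) * a3 =
      B1 * taylor_coeff u 1 * a2 + B1 * taylor_coeff u 2 + B2 * (taylor_coeff u 1)\<^sup>2"
    using S_star_coefficients[OF assms(1) \<phi>0 assms(3)] assms(4-9) by metis
  define c d where "c = taylor_coeff u 1" and "d = taylor_coeff u 2"
  define K where "K = B1 / (g3 - 1)"
  define \<mu> where "\<mu> = B2 / B1 + B1 / (g2 - 1)"
  define \<nu> where "\<nu> = B2 / B1 + B1 / (g2 - 1) * (1 - 2 * ((g3 - 1) / (g2 - 1)))"
  have nz: "g2 - 1 \<noteq> 0" "complex_of_real g3 - 1 \<noteq> 0" "complex_of_real B1 \<noteq> 0"
    using assms(10,11) B1 by auto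
  have K: "K > 0"
    using B1 assms(11) by (simp add: K_def)
  have a2: "a2 = B1 * c / (g2 - 1)"
    using coeff2 nz by (simp add: c_def field_simps)
  have B1_\<mu>: "B2 + B1 * B1 / (g2 - 1) = B1 * \<mu>"
    using nz by (simp add: \<mu>_def ring_distribs)
  have "a3 = (B1 * c * a2 + B1 * d + B2 * c\<^sup>2) / (complex_of_real g3 - 1)"
    using coeff3 nz by (simp add: c_def d_def field_simps)
  also have "\<dots> = K * (d + \<mu> * c\<^sup>2)"
  proof -
    have "B1 * c * a2 + B1 * d + B2 * c\<^sup>2 = B1 * d + (B2 + B1 * B1 / (g2 - 1)) * c\<^sup>2"
      unfolding a2 by (simp add: algebra_simps power2_eq_square)
    also have "\<dots> = B1 * (d + \<mu> * c\<^sup>2)"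
      unfolding B1_\<mu> by (simp add: algebra_simps)
    finally show ?thesis
      by (simp add: K_def)
  qed
  finally have a3: "a3 = K * (d + \<mu> * c\<^sup>2)" .
  \<comment> \<open>Subtracting \<open>2 a\<^sub>2\<^sup>2\<close> from \<open>a\<^sub>3\<close> amounts to replacing \<open>\<mu>\<close> by \<open>\<nu>\<close>.\<close>
  have "K * ((\<mu> - \<nu>) * c\<^sup>2) = 2 * a2\<^sup>2"
  proof -
    define w where "w = complex_of_real g3 - 1"
    have w: "w \<noteq> 0"
      using nz(2) by (simp add: w_def)
    have "\<mu> - \<nu> = B1 / (g2 - 1) * (2 * (w / (g2 - 1)))"
      by (simp add: \<mu>_def \<nu>_def w_def right_diff_distrib)
    moreover have "complex_of_real K = B1 / w"
      by (simp add: K_def w_def)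
    ultimately show ?thesis
      using w unfolding a2 by (simp add: power2_eq_square)
  qed
  then have a3': "a3 - 2 * a2\<^sup>2 = K * (d + \<nu> * c\<^sup>2)"
    unfolding a3 by (simp add: algebra_simps)
  have bound: "norm (K * (d + \<kappa> * c\<^sup>2)) \<le> K * max 1 (norm \<kappa>)" for \<kappa>
    unfolding c_def d_def norm_mult norm_of_real
    using K schwarz_fekete_szego[OF u, of \<kappa>] by simp
  have "norm ((1 - a3) * (1 + (a3 - 2 * a2\<^sup>2))) = norm (1 + (a3 - 2 * a2\<^sup>2)) * norm (1 - a3)"
    by (simp add: norm_mult)
  also have "\<dots> \<le> (1 + norm (a3 - 2 * a2\<^sup>2)) * (1 + norm a3)"
    by (intro mult_mono order_trans[OF norm_triangle_ineq] order_trans[OF norm_triangle_ineq4]) auto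
  also have "\<dots> \<le> (1 + K * max 1 (norm \<nu>)) * (1 + K * max 1 (norm \<mu>))"
    unfolding a3' unfolding a3 using K
    by (intro mult_mono add_left_mono bound add_nonneg_nonneg mult_nonneg_nonneg) auto
  finally show ?thesis
    unfolding det_symmetric_toeplitz_3 K_def \<mu>_def \<nu>_def .
qed

end
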